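(* Let $s\ge 2$ be an integer and let $p\ge 3$ be an odd prime. Then there exist integers $s'=s'(s,p)$ and $d'=d'(s,p)$ with $1\le d'\le p$ such that for every positive integer $n$, $$\nu_p(f_n(s,-1))=\delta_{d'\mathbb{Z}}(n)\,\nu_p\!\left(\frac{s'n}{d'}\right).$$
   Context: For integers $s,t$, the generalized Fibonacci sequence is $f_0(s,t)=0$, $f_1(s,t)=1$, $f_n(s,t)=s f_{n-1}(s,t)+t f_{n-2}(s,t)$ for $n\ge2$. $\nu_p$ is the $p$-adic valuation (extended to nonzero rationals). For a positive integer $d'$, $\delta_{d'\mathbb{Z}}(n)$ equals $1$ if $d'\mid n$ and $0$ otherwise. *)

theory Defs
  imports Complex_Main "HOL-Computational_Algebra.Primes"
begin

fun genfib :: "int \<Rightarrow> int \<Rightarrow> nat \<Rightarrow> int" where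
  "genfib s t 0 = 0"
| "genfib s t (Suc 0) = 1"
| "genfib s t (Suc (Suc n)) = s * genfib s t (Suc n) + t * genfib s t n"

text \<open>
  The valuation is only meaningful at nonzero rationals and a prime \<open>p\<close>; at \<open>0\<close> this
  definition yields the junk value \<open>0\<close>.
\<close>

definition padic_val :: "nat \<Rightarrow> rat \<Rightarrow> int" where
  "padic_val p x = int (multiplicity (int p) (fst (quotient_of x)))
                 - int (multiplicity (int p) (snd (quotient_of x)))"

definition delta_multiples :: "int \<Rightarrow> int \<Rightarrow> int" where
  "delta_multiples d n = (if d dvd n then 1 else 0)"

text \<open>The junk value is not reached at \<open>genfib s (-1) n\<close> for \<open>s \<ge> 2\<close> and \<open>n > 0\<close>.\<close>

lemma genfib_minus_one_pos:
  assumes "s \<ge> 2" and "n > 0"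
  shows "genfib s (-1) n > 0"
proof -
  have "0 \<le> genfib s (-1) m \<and> genfib s (-1) m < genfib s (-1) (Suc m)" for m
  proof (induction m)
    case 0
    show ?case by simp
  next
    case (Suc m)
    have "2 * genfib s (-1) (Suc m) \<le> s * genfib s (-1) (Suc m)"
      using assms(1) Suc by (intro mult_right_mono) auto
    with Suc show ?case unfolding genfib.simps by linarith
  qed
  from this[of "n - 1"] assms(2) show ?thesis by simp
qed

end

theory Submission
  imports Defs "HOL-Number_Theory.Cong"
begin

text \<open>
  Write \<open>f n\<close> for \<open>genfib s (-1) n\<close> and let \<open>d\<close> be the least positive index with \<open>p\<close> dividing
  \<open>f d\<close>; then \<open>s' = f d\<close> and \<open>d' = d\<close> work.

  Bound \<open>d \<le> p\<close>: otherwise the ratios \<open>f (n + 1) / f n\<close> for \<open>1 \<le> n < p\<close> are pairwise distinct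
  modulo \<open>p\<close>, hence exhaust the nonzero residues. This forces \<open>p\<close> to divide \<open>f (p + 1)\<close>.
  A ratio equal to \<open>1\<close> gives \<open>p\<close> dividing \<open>f (2 n + 1)\<close>, since
  \<open>f (2 n + 1) = (f (n + 1))\<^sup>2 - (f n)\<^sup>2\<close>. As \<open>2 n + 1\<close> is odd, less than \<open>2 p + 1\<close> and different
  from \<open>p + 1\<close>, it reduces modulo \<open>p + 1\<close> to a positive index at most \<open>p\<close>.

  Valuation: \<open>f (n k) = f n * genfib v (-1) k\<close> with \<open>v = 2 f (n + 1) - s f n\<close> and
  \<open>v\<^sup>2 - 4 = (s\<^sup>2 - 4) (f n)\<^sup>2\<close>. For \<open>n = d\<close> this makes \<open>v\<close> congruent to \<open>2\<close> or \<open>-2\<close> modulo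
  \<open>p\<^sup>2\<close>, and so \<open>genfib v (-1) k\<close> is congruent to \<open>k\<close> or \<open>-k\<close> modulo \<open>p\<^sup>2\<close>. This settles
  \<open>k\<close> prime to \<open>p\<close> and \<open>k = p\<close>; the general case follows by splitting off factors \<open>p\<close>
  from \<open>k\<close>, using the same factorisation.
\<close>

section \<open>Polynomial identities for the sequence\<close>

text \<open>The step for each identity uses the other, hence the joint induction. The factor
  \<open>genfib s (-1) (Suc n) - s * genfib s (-1) n\<close> stands for minus the preceding term, so
  \<open>n = 0\<close> needs no exception.\<close>

lemma genfib_add:
  "genfib s (-1) (m + n) = genfib s (-1) (Suc m) * genfib s (-1) n
      + genfib s (-1) m * (genfib s (-1) (Suc n) - s * genfib s (-1) n)"
  "genfib s (-1) (Suc (m + n)) = genfib s (-1) (Suc m) * genfib s (-1) (Suc n)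
      - genfib s (-1) m * genfib s (-1) n"
proof (induction m)
  case (Suc m)
  { case 1 show ?case using Suc by (simp add: algebra_simps) }
  { case 2 show ?case by (simp add: Suc.IH) (simp add: algebra_simps) }
qed simp_all

text \<open>The form \<open>x^2 - s*x*y + y^2\<close> is preserved by the recurrence map from
  \<open>(x, y)\<close> to \<open>(s*x - y, x)\<close>.\<close>

lemma genfib_invariant:
  "(genfib s (-1) (Suc n))\<^sup>2 - s * genfib s (-1) n * genfib s (-1) (Suc n) + (genfib s (-1) n)\<^sup>2 = 1"
  by (induction n) (simp_all add: algebra_simps power2_eq_square)

lemma genfib_cross:
  "genfib s (-1) (Suc (n + k)) * genfib s (-1) n - genfib s (-1) (Suc n) * genfib s (-1) (n + k)
     = - genfib s (-1) k"
proof -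
  have "genfib s (-1) (Suc (n + k)) * genfib s (-1) n - genfib s (-1) (Suc n) * genfib s (-1) (n + k)
     = - genfib s (-1) k * ((genfib s (-1) (Suc n))\<^sup>2
         - s * genfib s (-1) n * genfib s (-1) (Suc n) + (genfib s (-1) n)\<^sup>2)"
    unfolding genfib_add by (simp add: algebra_simps power2_eq_square)
  then show ?thesis by (simp add: genfib_invariant)
qed

lemma genfib_odd:
  "genfib s (-1) (Suc (2 * n)) = (genfib s (-1) (Suc n) - genfib s (-1) n)
      * (genfib s (-1) (Suc n) + genfib s (-1) n)"
  using genfib_add(2)[of s n n] by (simp add: algebra_simps flip: mult_2)

text \<open>With \<open>a\<close>, \<open>b\<close> the roots of \<open>x^2 - s*x + 1\<close>, the
  new parameter is \<open>a^n + b^n\<close>; as \<open>a*b = 1\<close>, the terms at multiples of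
  \<open>n\<close> obey the recurrence with that parameter.\<close>

lemma genfib_mult:
  "genfib s (-1) (n * k) = genfib s (-1) n
      * genfib (2 * genfib s (-1) (Suc n) - s * genfib s (-1) n) (-1) k"
proof (induction k rule: induct_nat_012)
  case (ge2 k)
  let ?f = "genfib s (-1)"
  have step: "?f (m + n + n) = (2 * ?f (Suc n) - s * ?f n) * ?f (m + n) - ?f m" for m
  proof -
    have "?f (m + n + n) - (2 * ?f (Suc n) - s * ?f n) * ?f (m + n) =
      - ?f m * ((?f (Suc n))\<^sup>2 - s * ?f n * ?f (Suc n) + (?f n)\<^sup>2)"
      unfolding genfib_add by (simp add: algebra_simps power2_eq_square)
    then show ?thesis by (simp add: genfib_invariant)
  qed
  from step[of "n * k"] ge2 show ?case by (simp add: algebra_simps)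
qed simp_all

lemma genfib_mult_discriminant:
  "(2 * genfib s (-1) (Suc n) - s * genfib s (-1) n)\<^sup>2 - 4 = (s\<^sup>2 - 4) * (genfib s (-1) n)\<^sup>2"
  using genfib_invariant[of s n] by (simp add: algebra_simps power2_eq_square)

section \<open>Valuations when the discriminant is divisible by the square of
  \<open>p\<close>\<close>

lemma genfib_cong:
  assumes "[s = s'] (mod m)"
  shows "[genfib s t n = genfib s' t n] (mod m)"
  by (induction n rule: induct_nat_012) (auto intro!: cong_add cong_mult assms)

lemma genfib_two: "genfib 2 (-1) n = int n"
  by (induction n rule: induct_nat_012) auto

lemma genfib_minus: "genfib (-s) t n = (-1) ^ Suc n * genfib s t n"
  by (induction n rule: induct_nat_012) (auto simp: algebra_simps)

lemma genfib_cong_index: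
  assumes p: "prime p" "odd p" and N: "(int p)\<^sup>2 dvd N\<^sup>2 - 4"
  shows "\<exists>e. \<bar>e\<bar> = 1 \<and> [genfib N (-1) k = e * int k] (mod (int p)\<^sup>2)"
proof -
  have pp: "prime (int p)" using p by simp
  have "\<not> int p dvd 4"
  proof
    assume "int p dvd 4"
    then have "int p dvd 2 ^ 2" by simp
    then have "int p dvd 2" by (rule prime_dvd_power[OF pp])
    then have "p dvd 2" by (metis int_dvd_int_iff of_nat_numeral)
    then have "p = 2" using p(1) by (simp add: primes_dvd_imp_eq)
    then show False using p(2) by simp
  qed
  then have "\<not> (int p dvd N - 2 \<and> int p dvd N + 2)"
    using dvd_diff[of "int p" "N + 2" "N - 2"] by auto
  then have "coprime ((int p)\<^sup>2) (N - 2) \<or> coprime ((int p)\<^sup>2) (N + 2)"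
    using prime_imp_coprime[OF pp, of "N - 2"] prime_imp_coprime[OF pp, of "N + 2"] by auto
  moreover have "(int p)\<^sup>2 dvd (N - 2) * (N + 2)"
    using N by (simp add: algebra_simps power2_eq_square)
  ultimately have "(int p)\<^sup>2 dvd N + 2 \<or> (int p)\<^sup>2 dvd N - 2"
    by (auto simp: coprime_dvd_mult_left_iff coprime_dvd_mult_right_iff)
  then have "[N = - 2] (mod (int p)\<^sup>2) \<or> [N = 2] (mod (int p)\<^sup>2)"
    by (auto simp: cong_iff_dvd_diff)
  then show ?thesis
  proof
    assume "[N = - 2] (mod (int p)\<^sup>2)"
    from genfib_cong[OF this, of "-1" k]
    have "[genfib N (-1) k = (-1) ^ Suc k * int k] (mod (int p)\<^sup>2)"
      by (simp only: genfib_minus genfib_two)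
    moreover have "\<bar>(-1 :: int) ^ Suc k\<bar> = 1" by (simp add: power_abs)
    ultimately show ?thesis by blast
  next
    assume "[N = 2] (mod (int p)\<^sup>2)"
    from genfib_cong[OF this, of "-1" k]
    have "[genfib N (-1) k = 1 * int k] (mod (int p)\<^sup>2)"
      by (simp only: genfib_two mult_1)
    then show ?thesis by (intro exI[of _ 1]) simp
  qed
qed

lemma multiplicity_genfib:
  assumes p: "prime p" "odd p" and N: "(int p)\<^sup>2 dvd N\<^sup>2 - 4" and k: "k > 0"
  shows "genfib N (-1) k \<noteq> 0 \<and> multiplicity (int p) (genfib N (-1) k) = multiplicity (int p) (int k)"
  using N k
proof (induction k arbitrary: N rule: less_induct)
  case (less k)
  have pp: "prime (int p)" using p by simp
  show ?case
  proof (cases "p dvd k")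
    case False
    obtain e where e: "\<bar>e\<bar> = 1" "[genfib N (-1) k = e * int k] (mod (int p)\<^sup>2)"
      using genfib_cong_index[OF p less.prems(1)] by blast
    have "[genfib N (-1) k = e * int k] (mod int p)"
      using e(2) by (rule cong_dvd_modulus) simp
    moreover have "\<not> int p dvd e * int k"
      using False e(1) by (auto simp: abs_if split: if_splits)
    ultimately have "\<not> int p dvd genfib N (-1) k"
      using cong_dvd_iff by blast
    then show ?thesis using False
      by (auto simp: not_dvd_imp_multiplicity_0)
  next
    case True
    then obtain j where j: "k = p * j" by blast
    have j0: "j > 0" "j < k" using j less.prems(2) p prime_gt_1_nat[of p] by auto
    let ?M = "2 * genfib N (-1) (Suc p) - N * genfib N (-1) p"
    have "(int p)\<^sup>2 dvd ?M\<^sup>2 - 4"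
      using less.prems(1) by (simp add: genfib_mult_discriminant)
    then have IH: "genfib ?M (-1) j \<noteq> 0"
      "multiplicity (int p) (genfib ?M (-1) j) = multiplicity (int p) (int j)"
      using less.IH[OF j0(2) _ j0(1)] by blast+
    obtain e where e: "\<bar>e\<bar> = 1" "[genfib N (-1) p = e * int p] (mod (int p)\<^sup>2)"
      using genfib_cong_index[OF p less.prems(1)] by blast
    have "[genfib N (-1) p = e * int p] (mod int p)"
      using e(2) by (rule cong_dvd_modulus) simp
    then have 1: "int p ^ 1 dvd genfib N (-1) p"
      using cong_dvd_iff by fastforce
    \<comment> \<open>Here the modulus \<open>p^2\<close> matters: it excludes a second factor
      \<open>p\<close>.\<close>
    have "\<not> (int p)\<^sup>2 dvd e * int p"
      using e(1) pp by (auto simp: abs_if power2_eq_square split: if_splits)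
    then have 2: "\<not> int p ^ Suc 1 dvd genfib N (-1) p"
      using cong_dvd_iff[OF e(2)] by (simp add: power2_eq_square)
    have 3: "multiplicity (int p) (genfib N (-1) p) = 1"
      by (rule multiplicity_eqI[OF 1 2])
    have 4: "genfib N (-1) p \<noteq> 0" using 2 by auto
    have "multiplicity (int p) (int p * int j) = Suc (multiplicity (int p) (int j))"
      using pp j0 by (subst multiplicity_times_same) auto
    with 3 4 IH show ?thesis
      unfolding j genfib_mult using pp
      by (simp add: prime_elem_multiplicity_mult_distrib)
  qed
qed

section \<open>Zeros modulo \<open>p\<close>\<close>

text \<open>By the invariant, \<open>p\<close> cannot divide two consecutive terms, so modulo
  \<open>p\<close> a shift by \<open>d\<close> multiplies by a unit.\<close>

lemma prime_dvd_genfib_add_iff: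
  assumes p: "prime p" and d: "int p dvd genfib s (-1) d"
  shows "int p dvd genfib s (-1) (n + d) \<longleftrightarrow> int p dvd genfib s (-1) n"
proof -
  let ?f = "genfib s (-1)"
  have pp: "prime (int p)" using p by simp
  have "\<not> int p dvd ?f (Suc d)"
  proof
    assume "int p dvd ?f (Suc d)"
    with d have "int p dvd (?f (Suc d))\<^sup>2 - s * ?f d * ?f (Suc d) + (?f d)\<^sup>2"
      by (auto intro!: dvd_add dvd_diff simp: power2_eq_square)
    then show False using pp by (simp only: genfib_invariant) (use not_prime_unit in blast)
  qed
  moreover have "?f (n + d) = ?f n * ?f (Suc d) + ?f d * (?f (Suc n) - s * ?f n)"
    by (simp add: genfib_add algebra_simps)
  then have "int p dvd ?f (n + d) \<longleftrightarrow> int p dvd ?f n * ?f (Suc d)"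
    using d by (simp add: dvd_add_left_iff)
  ultimately show ?thesis using pp by (simp add: prime_dvd_mult_iff)
qed

lemma nonzero_ratio_mod_prime:
  assumes p: "prime p" and a: "\<not> int p dvd a" and b: "\<not> int p dvd b"
  shows "\<exists>r\<in>{0<..<int p}. [b = r * a] (mod int p)"
proof -
  have "coprime a (int p)"
    using a p prime_imp_coprime[of "int p" a] by (simp add: coprime_commute)
  then obtain x where x: "[a * x = 1] (mod int p)"
    using cong_solve_coprime_int by blast
  define r where "r = (b * x) mod int p"
  have "[r * a = b * (a * x)] (mod int p)"
    unfolding r_def cong_def by (simp add: mod_mult_right_eq ac_simps)
  also have "[b * (a * x) = b * 1] (mod int p)"
    by (intro cong_mult x cong_refl)
  finally have r: "[b = r * a] (mod int p)" by (simp add: cong_sym)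
  then have "r \<noteq> 0" using b by (auto simp: cong_0_iff)
  moreover have "0 \<le> r" "r < int p"
    unfolding r_def using prime_gt_0_nat[OF p] by auto
  ultimately show ?thesis using r by (intro bexI[of _ r]) auto
qed

lemma genfib_zero_mod_prime:
  assumes p: "prime p" and odd: "odd p"
  shows "\<exists>d. 0 < d \<and> d \<le> p \<and> int p dvd genfib s (-1) d"
proof (rule ccontr)
  let ?f = "genfib s (-1)"
  assume "\<not> ?thesis"
  then have nz: "\<not> int p dvd ?f d" if "0 < d" "d \<le> p" for d using that by blast
  have p1: "p > 1" using p prime_gt_1_nat by blast
  have "\<exists>r\<in>{0<..<int p}. [?f (Suc n) = r * ?f n] (mod int p)" if "n \<in> {0<..<p}" for n
    using nonzero_ratio_mod_prime[OF p nz nz, of n "Suc n"] that by auto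
  then obtain r where r: "\<And>n. n \<in> {0<..<p} \<Longrightarrow> r n \<in> {0<..<int p}"
      "\<And>n. n \<in> {0<..<p} \<Longrightarrow> [?f (Suc n) = r n * ?f n] (mod int p)"
    by metis
  \<comment> \<open>Equal ratios at \<open>n\<close> and \<open>m\<close> would make
    \<open>p\<close> divide the term at \<open>m - n\<close>. The case \<open>m = p\<close> is
    included for the step to \<open>Suc p\<close>.\<close>
  have distinct: "\<not> [?f (Suc m) = a * ?f m] (mod int p)"
    if "[?f (Suc n) = a * ?f n] (mod int p)" "0 < n" "n < m" "m \<le> p" for n m a
  proof
    assume m: "[?f (Suc m) = a * ?f m] (mod int p)"
    have "[?f (Suc m) * ?f n - ?f (Suc n) * ?f m = (a * ?f m) * ?f n - (a * ?f n) * ?f m] (mod int p)"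
      by (intro cong_diff cong_mult m that(1) cong_refl)
    moreover have "?f (Suc m) * ?f n - ?f (Suc n) * ?f m = - ?f (m - n)"
      using genfib_cross[of s n "m - n"] that(3) by simp
    ultimately have "int p dvd ?f (m - n)"
      by (simp add: cong_0_iff mult.commute mult.left_commute)
    moreover have "0 < m - n" "m - n \<le> p" using that by auto
    ultimately show False using nz by blast
  qed
  have inj: "inj_on r {0<..<p}"
  proof (rule linorder_inj_onI)
    fix n m assume "n < m" "n \<in> {0<..<p}" "m \<in> {0<..<p}"
    then show "r n \<noteq> r m" using distinct[of n "r n" m] r(2)[of n] r(2)[of m] by auto
  qed auto
  have surj: "r ` {0<..<p} = {0<..<int p}"
  proof (rule card_subset_eq)
    show "card (r ` {0<..<p}) = card {0<..<int p}"
      using p1 by (simp add: card_image[OF inj] nat_diff_distrib)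
  qed (use r(1) in auto)
  have "int p dvd ?f (Suc p)"
  proof (rule ccontr)
    \<comment> \<open>The ratio at \<open>p\<close> would then be a nonzero residue, all of which
      are already taken.\<close>
    assume np: "\<not> int p dvd ?f (Suc p)"
    obtain a where a: "a \<in> {0<..<int p}" "[?f (Suc p) = a * ?f p] (mod int p)"
      using nonzero_ratio_mod_prime[OF p nz[of p] np] p1 by auto
    then have "a \<in> r ` {0<..<p}" unfolding surj by simp
    then obtain n where "n \<in> {0<..<p}" "a = r n" by blast
    with distinct[of n a p] r(2)[of n] a show False by auto
  qed
  note period = prime_dvd_genfib_add_iff[OF p this]
  have "1 \<in> r ` {0<..<p}" unfolding surj using p1 by auto
  then obtain n where n: "n \<in> {0<..<p}" "r n = 1" by force
  then have "[?f (Suc n) = ?f n] (mod int p)" using r(2)[of n] by simp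
  then have dvd: "int p dvd ?f (Suc (2 * n))"
    unfolding genfib_odd by (simp add: cong_iff_dvd_diff)
  show False
  proof (cases "2 * n < p")
    case True
    then show ?thesis using dvd nz[of "Suc (2 * n)"] by auto
  next
    case False
    \<comment> \<open>At \<open>2 * n = p\<close> the index would be \<open>Suc p\<close>, a
      legitimate zero giving no contradiction.\<close>
    moreover have "2 * n \<noteq> p" using odd by auto
    ultimately have gt: "2 * n > p" by simp
    then have "Suc (2 * n) = (2 * n - p) + Suc p" by simp
    then have "int p dvd ?f (2 * n - p)" using dvd period[of "2 * n - p"] by metis
    moreover have "0 < 2 * n - p" "2 * n - p \<le> p" using n(1) gt by auto
    ultimately show ?thesis using nz by blast
  qed
qed

lemma prime_dvd_genfib_iff:
  assumes p: "prime p" and d: "d > 0" "int p dvd genfib s (-1) d"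
    and least: "\<And>m. 0 < m \<Longrightarrow> m < d \<Longrightarrow> \<not> int p dvd genfib s (-1) m"
  shows "int p dvd genfib s (-1) n \<longleftrightarrow> d dvd n"
proof (induction n rule: less_induct)
  case (less n)
  show ?case
  proof (cases "n < d")
    case True
    then show ?thesis using least[of n] by (cases "n = 0") (auto dest: dvd_imp_le)
  next
    case False
    then have "int p dvd genfib s (-1) n \<longleftrightarrow> int p dvd genfib s (-1) (n - d)"
      using prime_dvd_genfib_add_iff[OF p d(2), of "n - d"] by simp
    also have "\<dots> \<longleftrightarrow> d dvd n - d" using less[of "n - d"] d(1) False by auto
    also have "\<dots> \<longleftrightarrow> d dvd n" using False by (simp add: dvd_minus_self)
    finally show ?thesis .
  qed
qed

lemma padic_val_of_int: "padic_val p (of_int a) = int (multiplicity (int p) a)"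
  by (simp add: padic_val_def)

theorem theorem12:
  fixes s :: int and p :: nat
  assumes "s \<ge> 2" and "prime p" and "p \<ge> 3"
  shows "\<exists>s' d' :: int. s' \<noteq> 0 \<and> 1 \<le> d' \<and> d' \<le> int p \<and>
           (\<forall>n::nat. n > 0 \<longrightarrow>
             padic_val p (of_int (genfib s (-1) n)) =
               delta_multiples d' (int n) * padic_val p (of_int s' * of_nat n / of_int d'))"
proof -
  let ?f = "genfib s (-1)"
  have odd: "odd p" using assms prime_odd_nat by simp
  have pp: "prime (int p)" using assms by simp
  define d where "d = (LEAST d. 0 < d \<and> int p dvd ?f d)"
  obtain d0 where d0: "0 < d0" "d0 \<le> p" "int p dvd ?f d0"
    using genfib_zero_mod_prime[OF assms(2) odd] by blast
  then have d: "0 < d" "int p dvd ?f d"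
    using LeastI[of "\<lambda>d. 0 < d \<and> int p dvd ?f d" d0] unfolding d_def by auto
  have dp: "d \<le> p"
    using Least_le[of "\<lambda>d. 0 < d \<and> int p dvd ?f d" d0] d0 unfolding d_def by auto
  have least: "\<not> int p dvd ?f m" if "0 < m" "m < d" for m
    using not_less_Least[of m "\<lambda>d. 0 < d \<and> int p dvd ?f d"] that unfolding d_def by auto
  \<comment> \<open>Nonvanishing makes the multiplicity additive on the product below.\<close>
  have fd: "?f d \<noteq> 0" using genfib_minus_one_pos[OF assms(1) d(1)] by simp
  have "padic_val p (of_int (?f n)) =
      delta_multiples (int d) (int n) * padic_val p (of_int (?f d) * of_nat n / of_int (int d))"
    if n: "n > 0" for n
  proof (cases "d dvd n")
    case False
    then have "\<not> int p dvd ?f n"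
      using prime_dvd_genfib_iff[OF assms(2) d least] by blast
    then show ?thesis using False
      by (simp add: padic_val_of_int delta_multiples_def not_dvd_imp_multiplicity_0)
  next
    case True
    then obtain k where k: "n = d * k" by blast
    have k0: "k > 0" using k n by auto
    let ?v = "2 * ?f (Suc d) - s * ?f d"
    have "(int p)\<^sup>2 dvd ?v\<^sup>2 - 4"
      using d(2) by (simp add: genfib_mult_discriminant)
    from multiplicity_genfib[OF assms(2) odd this k0] fd pp
    have "multiplicity (int p) (?f n) = multiplicity (int p) (?f d * int k)"
      using k0 by (simp add: k genfib_mult prime_elem_multiplicity_mult_distrib)
    \<comment> \<open>The quotient is an integer, so only integer multiplicities are
      compared.\<close>
    moreover have "(of_int (?f d) * of_nat n / of_int (int d) :: rat) = of_int (?f d * int k)"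
      using d(1) by (simp add: k)
    ultimately show ?thesis using True
      by (simp only: padic_val_of_int) (simp add: delta_multiples_def)
  qed
  then show ?thesis
    using fd d(1) dp by (intro exI[of _ "?f d"] exI[of _ "int d"]) auto
qed

end
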